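(* Let $L_{eq}=\{a^nb^n\mid n\ge 0\}\subseteq\{a,b\}^*$. There exists a constant $n$ such that for every $\epsilon>0$ one can construct an $n$-state two-way quantum finite automaton with restart which recognizes $L_{eq}$ with one-sided error bound $\epsilon$ within $O\big(\frac1\epsilon|w|\big)$ expected runtime, where $w$ is the input string.
   Context: Let $\vdash,\dashv$ be end-markers, $\Sigma=\{a,b\}$, $\Gamma=\Sigma\cup\{\vdash,\dashv\}$. A two-way quantum finite automaton with restart consists of a finite state set $Q$ partitioned into $Q_{non}$ (nonhalting), $Q_{acc}$, $Q_{rej}$, $Q_{restart}$, an initial state $q_0\in Q_{non}$, and a transition function $\delta:Q\times\Gamma\times Q\times\{-1,0,1\}\to\mathbb{C}$. On input $w$ let $x=\vdash w\dashv=x_0x_1\cdots x_{N-1}$, $N=|w|+2$; configurations are pairs $(q,i)\in Q\times\mathbb{Z}_N$, and $\delta$ must be such that for every $w$ the operator $U^w$ on $\ell_2(Q\times\mathbb{Z}_N)$ given by $U^w|q,i\rangle=\sum_{q',d}\delta(q,x_i,q',d)|q',i+d\bmod N\rangle$ is unitary. The computation starts in $|q_0,0\rangle$; each step applies $U^w$ and then performs the projective measurement onto the spans of configurations whose state lies in $Q_{acc}$, $Q_{rej}$, $Q_{non}$, $Q_{restart}$ respectively: "accept"/"reject" halt with that answer; "nonhalting" continues from the normalized projection onto the nonhalting configurations; "restart" continues from $|q_0,0\rangle$. Acceptance/rejection probabilities are those of eventually accepting/rejecting. A machine recognizes $L$ with one-sided error bound $\epsilon$ if either it accepts every member of $L$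 with probability 1 and rejects every nonmember with probability at least $1-\epsilon$, or it rejects every nonmember with probability 1 and accepts every member with probability at least $1-\epsilon$. *)

theory Defs
  imports "HOL-Analysis.Analysis"
begin

datatype letter = LetA | LetB

datatype tape_symbol = LeftEnd | RightEnd | Letter letter

datatype outcome = Accept | Reject | Nonhalt | Restart

text \<open>
  The partition of the state set is given by the map \<open>kind\<close>: for instance, the rejecting
  states are the \<open>q \<in> states M\<close> with \<open>kind M q = Reject\<close>. The last argument
  of \<open>trans\<close> is the head move; only the moves \<open>-1, 0, 1\<close> are ever used.
\<close>

record 'q tqfa =
  states :: "'q set"
  kind :: "'q \<Rightarrow> outcome"
  start :: 'q
  trans :: "'q \<Rightarrow> tape_symbol \<Rightarrow> 'q \<Rightarrow> int \<Rightarrow> complex"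

definition tape :: "letter list \<Rightarrow> tape_symbol list" where
  "tape w = LeftEnd # map Letter w @ [RightEnd]"

definition configs :: "'q tqfa \<Rightarrow> letter list \<Rightarrow> ('q \<times> int) set" where
  "configs M w = states M \<times> {0..<int (length (tape w))}"

text \<open>
  The matrix entry of the evolution operator from \<open>(q, i)\<close> to \<open>(q', j)\<close>. For
  the empty input the tape has two cells, so the moves \<open>-1\<close> and \<open>1\<close> lead to
  the same cell and their amplitudes add up.
\<close>

definition amplitude :: "'q tqfa \<Rightarrow> letter list \<Rightarrow> 'q \<times> int \<Rightarrow> 'q \<times> int \<Rightarrow> complex" where
  "amplitude M w = (\<lambda>(q', j) (q, i).
     \<Sum>d \<in> {d \<in> {-1, 0, 1}. (i + d) mod int (length (tape w)) = j}.
       trans M q (tape w ! nat i) q' d)"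

definition unitary_on :: "'c set \<Rightarrow> ('c \<Rightarrow> 'c \<Rightarrow> complex) \<Rightarrow> bool" where
  "unitary_on S U \<longleftrightarrow>
     (\<forall>c\<in>S. \<forall>c'\<in>S. (\<Sum>e\<in>S. cnj (U e c) * U e c') = (if c = c' then 1 else 0)) \<and>
     (\<forall>c\<in>S. \<forall>c'\<in>S. (\<Sum>e\<in>S. U c e * cnj (U c' e)) = (if c = c' then 1 else 0))"

definition two_way_qfa_restart :: "'q tqfa \<Rightarrow> bool" where
  "two_way_qfa_restart M \<longleftrightarrow>
     finite (states M) \<and> start M \<in> states M \<and> kind M (start M) = Nonhalt \<and>
     (\<forall>w. unitary_on (configs M w) (amplitude M w))"

type_synonym 'q qstate = "'q \<times> int \<Rightarrow> complex"

definition init :: "'q tqfa \<Rightarrow> 'q qstate" where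
  "init M = (\<lambda>c. if c = (start M, 0) then 1 else 0)"

definition evolve :: "'q tqfa \<Rightarrow> letter list \<Rightarrow> 'q qstate \<Rightarrow> 'q qstate" where
  "evolve M w \<psi> = (\<lambda>c. \<Sum>e\<in>configs M w. amplitude M w c e * \<psi> e)"

definition project :: "'q tqfa \<Rightarrow> letter list \<Rightarrow> outcome \<Rightarrow> 'q qstate \<Rightarrow> 'q qstate" where
  "project M w k \<psi> = (\<lambda>c. if c \<in> configs M w \<and> kind M (fst c) = k then \<psi> c else 0)"

definition vnorm :: "'q tqfa \<Rightarrow> letter list \<Rightarrow> 'q qstate \<Rightarrow> real" where
  "vnorm M w \<psi> = L2_set (\<lambda>c. cmod (\<psi> c)) (configs M w)"

definition outcome_prob :: "'q tqfa \<Rightarrow> letter list \<Rightarrow> 'q qstate \<Rightarrow> outcome \<Rightarrow> real" where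
  "outcome_prob M w \<psi> k = (vnorm M w (project M w k (evolve M w \<psi>)))\<^sup>2"

text \<open>
  An outcome of probability 0 yields the zero vector here, which is harmless since every history
  passing through it has probability 0.
\<close>

definition next_state :: "'q tqfa \<Rightarrow> letter list \<Rightarrow> 'q qstate \<Rightarrow> outcome \<Rightarrow> 'q qstate" where
  "next_state M w \<psi> k =
     (if k = Restart then init M
      else (let \<phi> = project M w k (evolve M w \<psi>)
            in (\<lambda>c. \<phi> c / complex_of_real (vnorm M w \<phi>))))"

text \<open>
  A history is the sequence of measurement outcomes observed so far, and \<open>history_prob\<close> is
  the probability of observing it when the current superposition is \<open>\<psi>\<close>. A run halts at
  its first outcome \<open>Accept\<close> or \<open>Reject\<close>, so halting runs correspond to the countably
  many histories in which precisely the last outcome is one of these two; the number of steps of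
  such a run is the length of its history.
\<close>

primrec history_prob :: "'q tqfa \<Rightarrow> letter list \<Rightarrow> 'q qstate \<Rightarrow> outcome list \<Rightarrow> real" where
  "history_prob M w \<psi> [] = 1"
| "history_prob M w \<psi> (k # ks) =
     outcome_prob M w \<psi> k * history_prob M w (next_state M w \<psi> k) ks"

definition histories :: "outcome \<Rightarrow> outcome list set" where
  "histories k = {ks @ [k] | ks. set ks \<subseteq> {Nonhalt, Restart}}"

definition accept_prob :: "'q tqfa \<Rightarrow> letter list \<Rightarrow> ennreal" where
  "accept_prob M w = (\<Sum>\<^sub>\<infinity>h\<in>histories Accept. ennreal (history_prob M w (init M) h))"

definition reject_prob :: "'q tqfa \<Rightarrow> letter list \<Rightarrow> ennreal" where
  "reject_prob M w = (\<Sum>\<^sub>\<infinity>h\<in>histories Reject. ennreal (history_prob M w (init M) h))"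

text \<open>
  The last summand accounts for the runs that never halt, whose runtime is infinite; it vanishes if
  the run halts almost surely, because \<open>top * 0 = 0\<close> in \<open>ennreal\<close>.
\<close>

definition expected_runtime :: "'q tqfa \<Rightarrow> letter list \<Rightarrow> ennreal" where
  "expected_runtime M w =
     (\<Sum>\<^sub>\<infinity>h\<in>histories Accept \<union> histories Reject.
        of_nat (length h) * ennreal (history_prob M w (init M) h))
     + top * (1 - (accept_prob M w + reject_prob M w))"

definition recognizes_one_sided :: "'q tqfa \<Rightarrow> letter list set \<Rightarrow> real \<Rightarrow> bool" where
  "recognizes_one_sided M L \<epsilon> \<longleftrightarrow>
     (\<forall>w\<in>L. accept_prob M w = 1) \<and> (\<forall>w\<in>- L. reject_prob M w \<ge> ennreal (1 - \<epsilon>)) \<or>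
     (\<forall>w\<in>- L. reject_prob M w = 1) \<and> (\<forall>w\<in>L. accept_prob M w \<ge> ennreal (1 - \<epsilon>))"

definition L_eq :: "letter list set" where
  "L_eq = {replicate n LetA @ replicate n LetB | n. True}"

end

theory Submission imports Defs begin

text \<open>
  After a reversible check of the form \<open>a\<^sup>*b\<^sup>*\<close>, the machine splits with
  equal amplitudes into two paths that sweep the tape to the left, one pausing on every \<open>a\<close>
  and the other on every \<open>b\<close>. They reach the left end simultaneously if and only if the
  numbers of letters agree; in that case a Hadamard transform cancels the rejecting amplitude,
  otherwise it rejects with probability \<open>1/2\<close>. The surviving branch accepts with
  probability \<open>\<epsilon>\<close> and restarts otherwise. A member is thus never rejected, and for a
  nonmember each round rejects with probability at least \<open>1/\<epsilon>\<close> times that of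
  accepting; every round is linear in the input and halts with probability at least
  \<open>\<epsilon>/2\<close>.
\<close>

subsection \<open>Runs with restarts\<close>

lemma infsum_ennreal_SUP:
  fixes f :: "'a \<Rightarrow> ennreal"
  shows "infsum f A = (SUP F\<in>{F. finite F \<and> F \<subseteq> A}. sum f F)"
  by (rule nonneg_infsum_complete) simp

lemma infsum_ennreal_cmult:
  fixes f :: "'a \<Rightarrow> ennreal"
  shows "infsum (\<lambda>x. c * f x) A = c * infsum f A"
proof -
  have "{F. finite F \<and> F \<subseteq> A} \<noteq> {}" by blast
  then show ?thesis
    by (simp add: infsum_ennreal_SUP SUP_mult_left_ennreal flip: sum_distrib_left)
qed

abbreviation halting_histories :: "outcome list set" where
  "halting_histories \<equiv> histories Accept \<union> histories Reject"

text \<open>Acceptance probability, rejection probability and expected number of steps all have this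
  form, with an indicator or the length as weight \<open>f\<close>; a general \<open>f\<close> lets
  one recursion serve all three.\<close>

definition history_sum ::
    "'q tqfa \<Rightarrow> letter list \<Rightarrow> (outcome list \<Rightarrow> ennreal) \<Rightarrow> 'q qstate \<Rightarrow> ennreal" where
  "history_sum M w f \<psi> =
     (\<Sum>\<^sub>\<infinity>h\<in>halting_histories. f h * ennreal (history_prob M w \<psi> h))"

lemma history_sum_mono:
  "(\<And>h. h \<in> halting_histories \<Longrightarrow> f h \<le> g h) \<Longrightarrow> history_sum M w f \<psi> \<le> history_sum M w g \<psi>"
  unfolding history_sum_def by (intro infsum_mono nonneg_summable_on_complete) (auto intro: mult_right_mono)

lemma history_sum_add:
  "history_sum M w (\<lambda>h. f h + g h) \<psi> = history_sum M w f \<psi> + history_sum M w g \<psi>"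
  unfolding history_sum_def by (subst infsum_add[symmetric]) (auto intro!: nonneg_summable_on_complete simp: distrib_right)

lemma history_sum_cmult:
  "history_sum M w (\<lambda>h. c * f h) \<psi> = c * history_sum M w f \<psi>"
  unfolding history_sum_def by (simp add: mult.assoc infsum_ennreal_cmult)

lemma histories_Cons:
  "histories k = insert [k] ((#) Nonhalt ` histories k \<union> (#) Restart ` histories k)"
proof (intro set_eqI iffI)
  fix h assume "h \<in> histories k"
  then obtain ks where ks: "h = ks @ [k]" "set ks \<subseteq> {Nonhalt, Restart}"
    by (auto simp: histories_def)
  then show "h \<in> insert [k] ((#) Nonhalt ` histories k \<union> (#) Restart ` histories k)"
    by (cases ks) (auto simp: histories_def image_iff)
next
  fix h assume h: "h \<in> insert [k] ((#) Nonhalt ` histories k \<union> (#) Restart ` histories k)"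
  have "x # ks @ [k] \<in> histories k"
    if "set ks \<subseteq> {Nonhalt, Restart}" "x \<in> {Nonhalt, Restart}" for x ks
    using that unfolding histories_def by (intro CollectI exI[of _ "x # ks"]) auto
  moreover have "[k] \<in> histories k" by (auto simp: histories_def)
  ultimately show "h \<in> histories k" using h by (auto simp: histories_def)
qed

lemma halting_histories_Cons:
  "halting_histories =
     {[Accept], [Reject]} \<union> ((#) Nonhalt ` halting_histories \<union> (#) Restart ` halting_histories)"
  using histories_Cons[of Accept] histories_Cons[of Reject] by blast

lemma Nil_notin_histories: "[] \<notin> histories k"
  by (auto simp: histories_def)

text \<open>First-step analysis. A first \<open>Restart\<close> leads to \<open>init M\<close>
  whatever \<open>\<psi>\<close> was, which later turns the recursion into an equation for a single
  unknown.\<close>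

lemma history_sum_Cons:
  "history_sum M w f \<psi> =
     f [Accept] * ennreal (outcome_prob M w \<psi> Accept) +
     f [Reject] * ennreal (outcome_prob M w \<psi> Reject) +
     ennreal (outcome_prob M w \<psi> Nonhalt) *
       history_sum M w (\<lambda>h. f (Nonhalt # h)) (next_state M w \<psi> Nonhalt) +
     ennreal (outcome_prob M w \<psi> Restart) *
       history_sum M w (\<lambda>h. f (Restart # h)) (init M)"
proof -
  let ?g = "\<lambda>h. f h * ennreal (history_prob M w \<psi> h)"
  have p0: "outcome_prob M w \<psi> k \<ge> 0" for k by (simp add: outcome_prob_def)
  have branch: "infsum ?g ((#) k ` halting_histories) =
      ennreal (outcome_prob M w \<psi> k) *
        history_sum M w (\<lambda>h. f (k # h)) (next_state M w \<psi> k)" for k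
    unfolding history_sum_def
    by (subst infsum_reindex)
       (auto simp: infsum_ennreal_cmult[symmetric] o_def ennreal_mult' p0 mult_ac intro!: infsum_cong)
  have "history_sum M w f \<psi> = infsum ?g
      ({[Accept], [Reject]} \<union> ((#) Nonhalt ` halting_histories \<union> (#) Restart ` halting_histories))"
    unfolding history_sum_def by (subst halting_histories_Cons) (rule refl)
  also have "\<dots> = infsum ?g {[Accept], [Reject]} + (infsum ?g ((#) Nonhalt ` halting_histories)
      + infsum ?g ((#) Restart ` halting_histories))"
    by (subst infsum_Un_disjoint; (subst infsum_Un_disjoint)?)
       (auto intro!: nonneg_summable_on_complete)
  finally show ?thesis
    unfolding branch by (simp add: next_state_def add_ac)
qed

section \<open>Norms and evolution without normalization\<close>

lemma vnorm_sq: "(vnorm M w \<psi>)\<^sup>2 = (\<Sum>c\<in>configs M w. (cmod (\<psi> c))\<^sup>2)"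
  by (simp add: vnorm_def L2_set_def sum_nonneg)

lemma vnorm_nonneg: "vnorm M w \<psi> \<ge> 0"
  by (simp add: vnorm_def)

lemma vnorm_divide: "vnorm M w (\<lambda>c. \<psi> c / complex_of_real r) = vnorm M w \<psi> / \<bar>r\<bar>"
proof -
  have "vnorm M w (\<lambda>c. \<psi> c / complex_of_real r) = L2_set (\<lambda>c. inverse \<bar>r\<bar> * cmod (\<psi> c)) (configs M w)"
    unfolding vnorm_def by (intro L2_set_cong) (auto simp: norm_divide divide_simps)
  then show ?thesis
    by (simp add: vnorm_def L2_set_right_distrib[symmetric] divide_inverse)
qed

lemma evolve_divide:
  "evolve M w (\<lambda>c. \<psi> c / r) = (\<lambda>c. evolve M w \<psi> c / r)"
  by (simp add: evolve_def sum_divide_distrib)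

lemma project_divide:
  "project M w k (\<lambda>c. \<psi> c / r) = (\<lambda>c. project M w k \<psi> c / r)"
  by (auto simp: project_def)

lemma outcome_prob_divide:
  "outcome_prob M w (\<lambda>c. \<psi> c / complex_of_real r) k = outcome_prob M w \<psi> k / r\<^sup>2"
  by (simp add: outcome_prob_def evolve_divide project_divide vnorm_divide power_divide)

lemma outcome_prob_nonneg: "outcome_prob M w \<psi> k \<ge> 0"
  by (simp add: outcome_prob_def)

definition step :: "'q tqfa \<Rightarrow> letter list \<Rightarrow> 'q qstate \<Rightarrow> 'q qstate" where
  "step M w \<psi> = project M w Nonhalt (evolve M w \<psi>)"

lemma vnorm_step: "(vnorm M w (step M w \<psi>))\<^sup>2 = outcome_prob M w \<psi> Nonhalt"
  by (simp add: step_def outcome_prob_def)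

text \<open>Scaling by the squared norm removes the normalization after each measurement.\<close>

definition weighted_sum ::
    "'q tqfa \<Rightarrow> letter list \<Rightarrow> (outcome list \<Rightarrow> ennreal) \<Rightarrow> 'q qstate \<Rightarrow> ennreal" where
  "weighted_sum M w f \<phi> = ennreal ((vnorm M w \<phi>)\<^sup>2) *
     history_sum M w f (\<lambda>c. \<phi> c / complex_of_real (vnorm M w \<phi>))"

text \<open>Expanding the squares and summing over \<open>c\<close> first leaves inner products of
  columns of \<open>U\<close>, which are orthonormal.\<close>

lemma unitary_on_isometry:
  assumes "finite S" and "unitary_on S U"
  shows "(\<Sum>c\<in>S. (cmod (\<Sum>e\<in>S. U c e * \<psi> e))\<^sup>2) = (\<Sum>c\<in>S. (cmod (\<psi> c))\<^sup>2)"
proof -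
  have "complex_of_real (\<Sum>c\<in>S. (cmod (\<Sum>e\<in>S. U c e * \<psi> e))\<^sup>2)
      = (\<Sum>c\<in>S. (\<Sum>e\<in>S. U c e * \<psi> e) * (\<Sum>e\<in>S. cnj (U c e * \<psi> e)))"
    by (simp add: complex_norm_square flip: of_real_power)
  also have "\<dots> = (\<Sum>c\<in>S. \<Sum>e\<in>S. \<Sum>e'\<in>S. \<psi> e * cnj (\<psi> e') * (cnj (U c e') * U c e))"
    by (simp add: sum_product mult_ac)
  also have "\<dots> = (\<Sum>e\<in>S. \<Sum>c\<in>S. \<Sum>e'\<in>S. \<psi> e * cnj (\<psi> e') * (cnj (U c e') * U c e))"
    by (rule sum.swap)
  also have "\<dots> = (\<Sum>e\<in>S. \<Sum>e'\<in>S. \<Sum>c\<in>S. \<psi> e * cnj (\<psi> e') * (cnj (U c e') * U c e))"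
    by (intro sum.cong refl sum.swap)
  also have "\<dots> = (\<Sum>e\<in>S. \<Sum>e'\<in>S. \<psi> e * cnj (\<psi> e') * (if e' = e then 1 else 0))"
    using assms(2) by (intro sum.cong refl) (simp add: unitary_on_def flip: sum_distrib_left)
  also have "\<dots> = (\<Sum>e\<in>S. \<psi> e * cnj (\<psi> e))"
    using assms(1) by (intro sum.cong refl) (simp add: if_distrib cong: if_cong)
  also have "\<dots> = complex_of_real (\<Sum>c\<in>S. (cmod (\<psi> c))\<^sup>2)"
    by (simp add: complex_norm_square flip: of_real_power)
  finally show ?thesis by (simp only: of_real_eq_iff)
qed

section \<open>Conservation of probability\<close>

locale machine =
  fixes M :: "'q tqfa" and w :: "letter list"
  assumes qfa: "two_way_qfa_restart M"
begin

lemma finite_configs: "finite (configs M w)"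
  using qfa by (simp add: configs_def two_way_qfa_restart_def)

lemma vnorm_evolve: "(vnorm M w (evolve M w \<psi>))\<^sup>2 = (vnorm M w \<psi>)\<^sup>2"
  using unitary_on_isometry[OF finite_configs, of "amplitude M w" \<psi>] qfa
  by (simp add: vnorm_sq evolve_def two_way_qfa_restart_def)

lemma sum_outcome_prob:
  "outcome_prob M w \<psi> Accept + outcome_prob M w \<psi> Reject + outcome_prob M w \<psi> Nonhalt
     + outcome_prob M w \<psi> Restart = (vnorm M w \<psi>)\<^sup>2"
proof -
  have *: "(cmod (project M w Accept \<phi> c))\<^sup>2 + (cmod (project M w Reject \<phi> c))\<^sup>2
      + (cmod (project M w Nonhalt \<phi> c))\<^sup>2 + (cmod (project M w Restart \<phi> c))\<^sup>2
      = (cmod (\<phi> c))\<^sup>2"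
    if "c \<in> configs M w" for c and \<phi> :: "'q qstate"
    using that by (cases "kind M (fst c)") (auto simp: project_def)
  show ?thesis
    unfolding vnorm_evolve[symmetric, of \<psi>]
    unfolding outcome_prob_def vnorm_sq sum.distrib[symmetric]
    by (intro sum.cong refl *)
qed

lemma vnorm_init: "vnorm M w (init M) = 1"
proof -
  have "(start M, 0) \<in> configs M w"
    using qfa by (auto simp: configs_def two_way_qfa_restart_def tape_def)
  then have "(vnorm M w (init M))\<^sup>2 = 1"
    unfolding vnorm_sq init_def using finite_configs
    by (simp add: if_distrib if_distribR cong: if_cong)
  with vnorm_nonneg[of M w "init M"] show ?thesis by (simp add: power2_eq_1_iff)
qed

lemma weighted_sum_init: "weighted_sum M w f (init M) = history_sum M w f (init M)"
  by (simp add: weighted_sum_def vnorm_init)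

text \<open>The squared norm in \<open>weighted_sum\<close> cancels the normalizations in
  \<open>history_sum_Cons\<close>, so nonhalting steps become iterates of the linear map
  \<open>step\<close>.\<close>

lemma weighted_sum_step:
  "weighted_sum M w f \<phi> =
     f [Accept] * ennreal (outcome_prob M w \<phi> Accept) +
     f [Reject] * ennreal (outcome_prob M w \<phi> Reject) +
     weighted_sum M w (\<lambda>h. f (Nonhalt # h)) (step M w \<phi>) +
     ennreal (outcome_prob M w \<phi> Restart) * history_sum M w (\<lambda>h. f (Restart # h)) (init M)"
\<comment> \<open>A vector of norm 0 cannot be normalized; its four outcome probabilities are
  nonnegative with sum 0, so both sides vanish.\<close>
proof (cases "vnorm M w \<phi> = 0")
  case True
  then have "outcome_prob M w \<phi> k = 0" for k
    using sum_outcome_prob[of \<phi>] outcome_prob_nonneg[of M w \<phi>]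
    by (cases k) (smt (verit) power_zero_numeral)+
  then show ?thesis using True
    by (simp add: weighted_sum_def vnorm_step)
next
  case False
  let ?r = "vnorm M w \<phi>" and ?\<psi> = "\<lambda>c. \<phi> c / complex_of_real (vnorm M w \<phi>)"
  have r: "?r > 0" using False vnorm_nonneg[of M w \<phi>] by simp
  have nxt: "next_state M w ?\<psi> Nonhalt =
      (\<lambda>c. step M w \<phi> c / complex_of_real (vnorm M w (step M w \<phi>)))"
    using r by (simp add: next_state_def Let_def evolve_divide project_divide vnorm_divide step_def)
  have p: "ennreal (?r\<^sup>2) * ennreal (outcome_prob M w ?\<psi> k) = ennreal (outcome_prob M w \<phi> k)" for k
    using r by (simp add: outcome_prob_divide outcome_prob_nonneg flip: ennreal_mult)
  have p': "ennreal (?r\<^sup>2) * (ennreal (outcome_prob M w ?\<psi> k) * x) = ennreal (outcome_prob M w \<phi> k) * x"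
       "ennreal (?r\<^sup>2) * (x * ennreal (outcome_prob M w ?\<psi> k)) = x * ennreal (outcome_prob M w \<phi> k)"
    for k x
    by (simp add: p flip: mult.assoc, subst mult.left_commute, simp add: p)
  show ?thesis
    unfolding weighted_sum_def[of M w f]
    by (subst history_sum_Cons)
       (simp add: distrib_left p' nxt weighted_sum_def vnorm_step add_ac)
qed

lemma weighted_sum_steps:
  "weighted_sum M w f \<phi> =
     (\<Sum>t<n. f (replicate t Nonhalt @ [Accept]) * ennreal (outcome_prob M w ((step M w ^^ t) \<phi>) Accept) +
            f (replicate t Nonhalt @ [Reject]) * ennreal (outcome_prob M w ((step M w ^^ t) \<phi>) Reject) +
            ennreal (outcome_prob M w ((step M w ^^ t) \<phi>) Restart) *
              history_sum M w (\<lambda>h. f (replicate t Nonhalt @ Restart # h)) (init M)) +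
     weighted_sum M w (\<lambda>h. f (replicate n Nonhalt @ h)) ((step M w ^^ n) \<phi>)"
proof (induction n)
  case (Suc n)
  show ?case
    by (subst Suc, subst weighted_sum_step) (simp add: add_ac replicate_app_Cons_same)
qed simp

lemma sum_outcome_prob_steps:
  "(\<Sum>t<n. outcome_prob M w ((step M w ^^ t) \<phi>) Accept + outcome_prob M w ((step M w ^^ t) \<phi>) Reject
       + outcome_prob M w ((step M w ^^ t) \<phi>) Restart) + (vnorm M w ((step M w ^^ n) \<phi>))\<^sup>2
     = (vnorm M w \<phi>)\<^sup>2"
proof (induction n)
  case (Suc n)
  then show ?case
    using sum_outcome_prob[of "(step M w ^^ n) \<phi>"] by (simp add: vnorm_step)
qed simp

text \<open>The length bound makes an induction possible: after any outcome, a restart included,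
  only histories of length at most \<open>m\<close> remain, whereas unbounded histories would lead
  from \<open>init M\<close> back to \<open>init M\<close>.\<close>

lemma weighted_sum_short_le:
  "weighted_sum M w (\<lambda>h. if length h \<le> m then 1 else 0) \<phi> \<le> ennreal ((vnorm M w \<phi>)\<^sup>2)"
proof (induction m arbitrary: \<phi>)
  case 0
  have "history_sum M w (\<lambda>h. if length h \<le> 0 then 1 else 0) \<psi> \<le> 0" for \<psi>
    unfolding history_sum_def
    by (intro order_eq_refl infsum_0) (auto simp: Nil_notin_histories)
  then show ?case by (simp add: weighted_sum_def)
next
  case (Suc m)
  have *: "history_sum M w (\<lambda>h. if length h \<le> m then 1 else 0) (init M) \<le> 1"
    using Suc[of "init M"] by (simp add: weighted_sum_init vnorm_init)
  have "weighted_sum M w (\<lambda>h. if length h \<le> Suc m then 1 else 0) \<phi> \<le>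
      ennreal (outcome_prob M w \<phi> Accept) + ennreal (outcome_prob M w \<phi> Reject) +
      ennreal (outcome_prob M w \<phi> Nonhalt) + ennreal (outcome_prob M w \<phi> Restart) * 1"
    by (subst weighted_sum_step, intro add_mono mult_left_mono)
       (use Suc[of "step M w \<phi>"] * in \<open>auto simp: vnorm_step\<close>)
  also have "\<dots> = ennreal ((vnorm M w \<phi>)\<^sup>2)"
    by (simp add: outcome_prob_nonneg flip: sum_outcome_prob ennreal_plus)
  finally show ?case .
qed

lemma history_sum_le_SUP:
  assumes "\<And>F. finite F \<Longrightarrow> F \<subseteq> halting_histories \<Longrightarrow>
      (\<Sum>h\<in>F. f h * ennreal (history_prob M w \<psi> h)) \<le> b"
  shows "history_sum M w f \<psi> \<le> b"
  unfolding history_sum_def infsum_ennreal_SUP using assms by (intro SUP_least) auto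

lemma finite_sum_le_history_sum:
  assumes "finite F" "F \<subseteq> halting_histories" and "\<And>h. h \<in> F \<Longrightarrow> f h \<le> g h"
  shows "(\<Sum>h\<in>F. f h * ennreal (history_prob M w \<psi> h)) \<le> history_sum M w g \<psi>"
proof -
  have "(\<Sum>h\<in>F. f h * ennreal (history_prob M w \<psi> h)) \<le> (\<Sum>h\<in>F. g h * ennreal (history_prob M w \<psi> h))"
    using assms(3) by (intro sum_mono mult_right_mono) auto
  also have "\<dots> \<le> history_sum M w g \<psi>"
    unfolding history_sum_def infsum_ennreal_SUP using assms(1,2) by (intro SUP_upper) auto
  finally show ?thesis .
qed

lemma finite_length_bound: "finite F \<Longrightarrow> \<exists>m. \<forall>h\<in>F. length h \<le> m"
  by (meson Max_ge finite_imageI imageI)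

text \<open>Every finite set of histories has a common length bound, so
  \<open>weighted_sum_short_le\<close> controls all finite partial sums.\<close>

lemma history_sum_one_le: "history_sum M w (\<lambda>h. 1) (init M) \<le> 1"
proof (rule history_sum_le_SUP)
  fix F assume F: "finite F" "F \<subseteq> halting_histories"
  obtain m where "\<forall>h\<in>F. length h \<le> m" using finite_length_bound[OF F(1)] by blast
  then have "(\<Sum>h\<in>F. 1 * ennreal (history_prob M w (init M) h))
      \<le> history_sum M w (\<lambda>h. if length h \<le> m then 1 else 0) (init M)"
    by (intro finite_sum_le_history_sum F) auto
  also have "\<dots> \<le> 1"
    using weighted_sum_short_le[of m "init M"] by (simp add: weighted_sum_init vnorm_init)
  finally show "(\<Sum>h\<in>F. 1 * ennreal (history_prob M w (init M) h)) \<le> 1" .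
qed

section \<open>Rounds between restarts and their renewal equations\<close>

abbreviation round_prob :: "nat \<Rightarrow> outcome \<Rightarrow> real" where
  "round_prob n k \<equiv> \<Sum>t<n. outcome_prob M w ((step M w ^^ t) (init M)) k"

context
  fixes n :: nat
  assumes stops: "vnorm M w ((step M w ^^ n) (init M)) = 0"
    and halts: "round_prob n Accept + round_prob n Reject > 0"
begin

text \<open>By \<open>stops\<close>, no amplitude survives \<open>n\<close> nonhalting steps, so the
  remainder of \<open>weighted_sum_steps\<close> is 0 and a round, the stretch between two restarts,
  has at most \<open>n\<close> steps.\<close>

lemma history_sum_round:
  "history_sum M w f (init M) =
     (\<Sum>t<n. f (replicate t Nonhalt @ [Accept]) * ennreal (outcome_prob M w ((step M w ^^ t) (init M)) Accept) +
            f (replicate t Nonhalt @ [Reject]) * ennreal (outcome_prob M w ((step M w ^^ t) (init M)) Reject) +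
            ennreal (outcome_prob M w ((step M w ^^ t) (init M)) Restart) *
              history_sum M w (\<lambda>h. f (replicate t Nonhalt @ Restart # h)) (init M))"
  using weighted_sum_steps[of f "init M" n] stops
  by (simp add: weighted_sum_init) (simp add: weighted_sum_def)

lemma round_prob_sum: "round_prob n Accept + round_prob n Reject + round_prob n Restart = 1"
  using sum_outcome_prob_steps[of "init M" n] by (simp add: stops vnorm_init sum.distrib)

lemma round_prob_nonneg: "round_prob n k \<ge> 0"
  by (intro sum_nonneg outcome_prob_nonneg)

lemma sum_ennreal_round:
  "(\<Sum>t<n. ennreal (outcome_prob M w ((step M w ^^ t) (init M)) k)) = ennreal (round_prob n k)"
  by (simp add: outcome_prob_nonneg sum_ennreal)

text \<open>A weight of the last outcome alone is blind to earlier rounds, so the sum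
  \<open>x\<close> solves \<open>x = g Accept * ?A + g Reject * ?R + s * x\<close>, where
  \<open>s = 1 - ?A - ?R\<close> is the probability that a round restarts.\<close>

lemma history_sum_last:
  fixes g :: "outcome \<Rightarrow> real"
  assumes g: "g Accept \<ge> 0" "g Accept \<le> 1" "g Reject \<ge> 0" "g Reject \<le> 1"
  shows "history_sum M w (\<lambda>h. ennreal (g (last h))) (init M) =
    ennreal ((g Accept * round_prob n Accept + g Reject * round_prob n Reject)
      / (round_prob n Accept + round_prob n Reject))"
    (is "?S = _")
proof -
  let ?A = "round_prob n Accept" and ?R = "round_prob n Reject"
  have S: "?S \<le> 1"
  proof -
    have "?S \<le> history_sum M w (\<lambda>h. 1) (init M)"
      using g by (intro history_sum_mono) (auto simp: histories_def)
    then show ?thesis using history_sum_one_le by simp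
  qed
  \<comment> \<open>Finiteness is essential: \<open>top\<close> also solves the equation whenever
    the restart probability is positive.\<close>
  then obtain x where x: "?S = ennreal x" "x \<ge> 0"
    by (metis ennreal_cases ennreal_one_neq_top top.extremum_unique)
  \<comment> \<open>The conditional is the simplified form of \<open>last (Restart # h)\<close>;
    halting histories are never empty.\<close>
  have [simp]: "history_sum M w (\<lambda>h. ennreal (g (if h = [] then Restart else last h))) (init M) = ?S"
    unfolding history_sum_def by (intro infsum_cong) (auto simp: Nil_notin_histories)
  have "ennreal x = ennreal (g Accept) * ennreal ?A + ennreal (g Reject) * ennreal ?R
      + ennreal (round_prob n Restart) * ennreal x"
    unfolding x(1)[symmetric] sum_ennreal_round[symmetric]
    by (subst history_sum_round) (simp add: sum.distrib sum_distrib_left sum_distrib_right)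
  then have "ennreal x = ennreal (g Accept * ?A + g Reject * ?R + round_prob n Restart * x)"
    using g x(2) round_prob_nonneg by (simp flip: ennreal_mult ennreal_plus)
  then have "x = g Accept * ?A + g Reject * ?R + round_prob n Restart * x"
    using g x(2) round_prob_nonneg by (subst (asm) ennreal_inj) auto
  moreover have "?A + ?R = 1 - round_prob n Restart" using round_prob_sum by linarith
  then have "x * (?A + ?R) = x - round_prob n Restart * x"
    by (simp only: right_diff_distrib mult.commute[of x] mult_1_left left_diff_distrib)
  ultimately have "x * (?A + ?R) = g Accept * ?A + g Reject * ?R"
    by linarith
  then have "x = (g Accept * ?A + g Reject * ?R) / (?A + ?R)"
    using halts by (simp add: eq_divide_eq)
  then show ?thesis by (simp only: x(1))
qed

lemma accept_prob_eq:
  "accept_prob M w = ennreal (round_prob n Accept / (round_prob n Accept + round_prob n Reject))"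
proof -
  have "accept_prob M w = history_sum M w (\<lambda>h. ennreal (if last h = Accept then 1 else 0)) (init M)"
    unfolding accept_prob_def history_sum_def
    by (rule infsum_cong_neutral) (auto simp: histories_def)
  then show ?thesis using history_sum_last[of "\<lambda>k. if k = Accept then 1 else 0"] by simp
qed

lemma reject_prob_eq:
  "reject_prob M w = ennreal (round_prob n Reject / (round_prob n Accept + round_prob n Reject))"
proof -
  have "reject_prob M w = history_sum M w (\<lambda>h. ennreal (if last h = Reject then 1 else 0)) (init M)"
    unfolding reject_prob_def history_sum_def
    by (rule infsum_cong_neutral) (auto simp: histories_def)
  then show ?thesis using history_sum_last[of "\<lambda>k. if k = Reject then 1 else 0"] by simp
qed

text \<open>Truncating the length keeps the sum finite, so that the restart equation can be solved.\<close>

lemma truncated_runtime_le: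
  "history_sum M w (\<lambda>h. of_nat (min (length h) m)) (init M)
     \<le> ennreal (real n / (round_prob n Accept + round_prob n Reject))"
    (is "?S \<le> _")
proof -
  let ?A = "round_prob n Accept" and ?R = "round_prob n Reject" and ?s = "round_prob n Restart"
  have "?S \<le> history_sum M w (\<lambda>h. of_nat m * 1) (init M)"
    by (intro history_sum_mono) (simp add: of_nat_min)
  also have "\<dots> \<le> of_nat m * 1"
    unfolding history_sum_cmult by (intro mult_left_mono history_sum_one_le) simp
  finally obtain x where x: "?S = ennreal x" "x \<ge> 0"
    by (metis ennreal_cases mult.right_neutral ennreal_of_nat_neq_top top.extremum_unique)
  \<comment> \<open>The prefix has length \<open>t + 1 \<le> n\<close>, so a round ending in a
    restart adds at most \<open>n\<close> to the truncated length.\<close>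
  have S: "history_sum M w (\<lambda>h. of_nat (min (length (replicate t Nonhalt @ Restart # h)) m)) (init M)
      \<le> of_nat n + ?S" if "t < n" for t
  proof -
    have "history_sum M w (\<lambda>h. of_nat (min (length (replicate t Nonhalt @ Restart # h)) m)) (init M)
        \<le> history_sum M w (\<lambda>h. of_nat n * 1 + of_nat (min (length h) m)) (init M)"
      using that by (intro history_sum_mono) (simp del: of_nat_add add: of_nat_add[symmetric])
    also have "\<dots> \<le> of_nat n * 1 + ?S"
      unfolding history_sum_add history_sum_cmult
      by (intro add_right_mono mult_left_mono history_sum_one_le) simp
    finally show ?thesis by simp
  qed
  have "?S \<le> (\<Sum>t<n. of_nat n * ennreal (outcome_prob M w ((step M w ^^ t) (init M)) Accept) +
            of_nat n * ennreal (outcome_prob M w ((step M w ^^ t) (init M)) Reject) +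
            ennreal (outcome_prob M w ((step M w ^^ t) (init M)) Restart) * (of_nat n + ?S))"
    by (subst history_sum_round, intro sum_mono add_mono mult_right_mono mult_left_mono S)
       auto
  also have "\<dots> = of_nat n * ennreal ?A + of_nat n * ennreal ?R + ennreal ?s * (of_nat n + ?S)"
    unfolding sum_ennreal_round[symmetric]
    by (simp add: sum.distrib sum_distrib_left sum_distrib_right)
  finally have "ennreal x \<le> ennreal (real n * ?A + real n * ?R + ?s * (real n + x))"
    unfolding x(1) using x(2) round_prob_nonneg
    by (simp add: ennreal_of_nat_eq_real_of_nat flip: ennreal_mult ennreal_plus)
  then have "x \<le> real n * ?A + real n * ?R + ?s * (real n + x)"
    using x(2) round_prob_nonneg by (subst (asm) ennreal_le_iff) auto
  also have "\<dots> = real n * (?A + ?R + ?s) + ?s * x" by (simp add: distrib_left distrib_right mult.commute)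
  finally have "x \<le> real n + ?s * x" using round_prob_sum by simp
  moreover have "?A + ?R = 1 - ?s" using round_prob_sum by linarith
  then have "x * (?A + ?R) = x - ?s * x"
    by (simp only: mult.commute[of x] mult_1_left left_diff_distrib)
  ultimately have "x * (?A + ?R) \<le> real n" by linarith
  then show ?thesis using halts by (simp add: x(1) le_divide_eq ennreal_leI)
qed

lemma expected_runtime_le:
  "expected_runtime M w \<le> ennreal (real n / (round_prob n Accept + round_prob n Reject))"
proof -
  have "history_sum M w (\<lambda>h. of_nat (length h)) (init M)
      \<le> ennreal (real n / (round_prob n Accept + round_prob n Reject))"
  proof (rule history_sum_le_SUP)
    fix F assume F: "finite F" "F \<subseteq> halting_histories"
    obtain m where "\<forall>h\<in>F. length h \<le> m" using finite_length_bound[OF F(1)] by blast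
    then have "(\<Sum>h\<in>F. of_nat (length h) * ennreal (history_prob M w (init M) h))
        \<le> history_sum M w (\<lambda>h. of_nat (min (length h) m)) (init M)"
      by (intro finite_sum_le_history_sum F) (auto simp: min_def)
    also note truncated_runtime_le
    finally show "(\<Sum>h\<in>F. of_nat (length h) * ennreal (history_prob M w (init M) h))
        \<le> ennreal (real n / (round_prob n Accept + round_prob n Reject))" .
  qed
  \<comment> \<open>This turns the summand for endless runs into \<open>top * 0\<close>.\<close>
  moreover have "accept_prob M w + reject_prob M w = 1"
    using halts round_prob_nonneg
    by (simp add: accept_prob_eq reject_prob_eq add_divide_distrib[symmetric] flip: ennreal_plus)
  ultimately show ?thesis by (simp add: expected_runtime_def history_sum_def)
qed

end

end

subsection \<open>Unidirectional machines\<close>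

lemma add_mod_eq_iff:
  fixes i j d N :: int
  assumes "0 \<le> i" "i < N" "0 \<le> j" "j < N"
  shows "(i + d) mod N = (j + d) mod N \<longleftrightarrow> i = j"
  using assms mod_diff_cong[of "i + d" N "j + d" d d] by auto

text \<open>
  The entering state determines the head move here (a \<open>unidirectional\<close> machine), so the evolution
  is a block diagonal unitary followed by a permutation of the configurations.
\<close>

lemma amplitude_unidirectional:
  assumes trans: "\<And>q \<sigma> q' d. trans M q \<sigma> q' d = (if d = D q' then V \<sigma> q' q else 0)"
    and D: "\<And>q. D q \<in> {-1, 0, 1}"
  shows "amplitude M w (q', j) (q, i) =
    (if (i + D q') mod int (length (tape w)) = j then V (tape w ! nat i) q' q else 0)"
proof -
  let ?S = "{d \<in> {-1, 0, 1}. (i + d) mod int (length (tape w)) = j}"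
  have "finite ?S" by simp
  \<comment> \<open>Only the move \<open>D q'\<close> carries amplitude, so even on a two-cell tape,
    where the moves \<open>-1\<close> and \<open>1\<close> coincide, nothing adds up.\<close>
  then have "(\<Sum>d\<in>?S. if d = D q' then V (tape w ! nat i) q' q else 0) =
      (if D q' \<in> ?S then V (tape w ! nat i) q' q else 0)"
    by (simp only: sum.delta)
  also have "D q' \<in> ?S \<longleftrightarrow> (i + D q') mod int (length (tape w)) = j"
    using D[of q'] by blast
  finally show ?thesis by (simp add: amplitude_def trans)
qed

text \<open>A row \<open>(q, j)\<close> fixes the move \<open>D q\<close>, so two columns overlap
  only if their positions agree, and then their inner product is one of columns of a single block.
  Two rows are compared position by position: orthonormal rows of each block force equal states,
  hence equal moves.\<close>

lemma unitary_on_unidirectional: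
  assumes trans: "\<And>q \<sigma> q' d. trans M q \<sigma> q' d = (if d = D q' then V \<sigma> q' q else 0)"
    and D: "\<And>q. D q \<in> {-1, 0, 1}"
    and V: "\<And>\<sigma>. unitary_on (states M) (V \<sigma>)"
    and fin: "finite (states M)"
  shows "unitary_on (configs M w) (amplitude M w)"
proof -
  define N where "N = int (length (tape w))"
  let ?x = "\<lambda>i. tape w ! nat i"
  have N: "N > 0" by (simp add: N_def tape_def)
  have amp: "amplitude M w (q', j) (q, i) = (if (i + D q') mod N = j then V (?x i) q' q else 0)"
    for q' j q i
    unfolding N_def by (rule amplitude_unidirectional[OF trans D])
  have cfg: "configs M w = states M \<times> {0..<N}" by (simp add: configs_def N_def)
  have col: "(\<Sum>e\<in>configs M w. cnj (amplitude M w e (q1, i1)) * amplitude M w e (q2, i2)) =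
      (if (q1, i1) = (q2, i2) then 1 else 0)"
    if "q1 \<in> states M" "q2 \<in> states M" "0 \<le> i1" "i1 < N" "0 \<le> i2" "i2 < N" for q1 q2 i1 i2
  proof -
    have "(\<Sum>e\<in>configs M w. cnj (amplitude M w e (q1, i1)) * amplitude M w e (q2, i2)) =
      (\<Sum>q\<in>states M. \<Sum>j\<in>{0..<N}. if j = (i1 + D q) mod N then
          (if i1 = i2 then cnj (V (?x i1) q q1) * V (?x i1) q q2 else 0) else 0)"
      unfolding cfg sum.cartesian_product'
      using add_mod_eq_iff[OF that(3-6)] add_mod_eq_iff[OF that(5,6,3,4)]
      by (intro sum.cong refl) (auto simp: amp)
    also have "\<dots> = (\<Sum>q\<in>states M. if i1 = i2 then cnj (V (?x i1) q q1) * V (?x i1) q q2 else 0)"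
      using N by (intro sum.cong refl) (subst sum.delta; simp)
    also have "\<dots> = (if (q1, i1) = (q2, i2) then 1 else 0)"
      using V[of "?x i1"] that by (cases "i1 = i2") (auto simp: unitary_on_def)
    finally show ?thesis .
  qed
  have row: "(\<Sum>e\<in>configs M w. amplitude M w (q1, j1) e * cnj (amplitude M w (q2, j2) e)) =
      (if (q1, j1) = (q2, j2) then 1 else 0)"
    if "q1 \<in> states M" "q2 \<in> states M" "0 \<le> j1" "j1 < N" "0 \<le> j2" "j2 < N" for q1 q2 j1 j2
  proof -
    have inv: "(i + d) mod N = j1 \<longleftrightarrow> i = (j1 - d) mod N" if "0 \<le> i" "i < N" for i d
    proof -
      have "((j1 - d) mod N + d) mod N = j1"
        using \<open>0 \<le> j1\<close> \<open>j1 < N\<close> by (simp add: mod_add_left_eq)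
      then show ?thesis
        using add_mod_eq_iff[OF that, of "(j1 - d) mod N" d] N by simp
    qed
    have "(\<Sum>e\<in>configs M w. amplitude M w (q1, j1) e * cnj (amplitude M w (q2, j2) e)) =
      (\<Sum>i\<in>{0..<N}. \<Sum>q\<in>states M. if (i + D q1) mod N = j1 \<and> (i + D q2) mod N = j2
          then V (?x i) q1 q * cnj (V (?x i) q2 q) else 0)"
      unfolding cfg sum.cartesian_product'
      by (subst sum.swap, intro sum.cong refl) (auto simp: amp)
    also have "\<dots> = (\<Sum>i\<in>{0..<N}. if (i + D q1) mod N = j1 \<and> (i + D q2) mod N = j2
          then (if q1 = q2 then 1 else 0) else 0)"
      using V that(1,2) by (intro sum.cong refl) (auto simp: unitary_on_def)
    also have "\<dots> = (\<Sum>i\<in>{0..<N}. if i = (j1 - D q1) mod N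
          then (if (q1, j1) = (q2, j2) then 1 else 0) else 0)"
      by (intro sum.cong refl) (auto simp: inv[symmetric])
    also have "\<dots> = (if (q1, j1) = (q2, j2) then 1 else 0)"
      using N by (subst sum.delta; simp)
    finally show ?thesis .
  qed
  show ?thesis unfolding unitary_on_def using col row by (auto simp: cfg)
qed

section \<open>Unitary matrices from permutations and reflections\<close>

lemma unitary_on_permute:
  assumes B: "unitary_on S B" and \<pi>: "bij_betw \<pi> S S"
  shows "unitary_on S (\<lambda>q' q. B q' (\<pi> q))"
proof -
  have "(\<Sum>e\<in>S. B c (\<pi> e) * cnj (B c' (\<pi> e))) = (\<Sum>e\<in>S. B c e * cnj (B c' e))" for c c'
    by (rule sum.reindex_bij_betw[OF \<pi>])
  then show ?thesis
    using B bij_betw_apply[OF \<pi>] inj_on_eq_iff[OF bij_betw_imp_inj_on[OF \<pi>]]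
    unfolding unitary_on_def by simp
qed

text \<open>Meant for an involution \<open>p\<close>: if \<open>a (p q) = - a q\<close> and
  \<open>s (p q) = s q\<close>, an exchanged pair carries the block with rows \<open>(a, s)\<close>
  and \<open>(s, -a)\<close>, a Hadamard matrix for \<open>a = s = 1 / sqrt 2\<close>. Fixed points
  of \<open>p\<close> take the first branch.\<close>

definition reflection :: "('q \<Rightarrow> 'q) \<Rightarrow> ('q \<Rightarrow> real) \<Rightarrow> ('q \<Rightarrow> real) \<Rightarrow> 'q \<Rightarrow> 'q \<Rightarrow> complex" where
  "reflection p a s q' q =
     complex_of_real (if q' = q then a q else if q' = p q then s q else 0)"

text \<open>The matrix is real and symmetric, so rows and columns obey the same relations. Column
  \<open>c\<close> lives on \<open>{c, p c}\<close>; against column \<open>p c\<close> the products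
  \<open>a c * s c\<close> and \<open>s c * a (p c)\<close> cancel.\<close>

lemma unitary_on_reflection:
  assumes fin: "finite S" and p: "\<And>q. q \<in> S \<Longrightarrow> p q \<in> S \<and> p (p q) = q"
    and fixed: "\<And>q. q \<in> S \<Longrightarrow> p q = q \<Longrightarrow> a q = 1"
    and moved: "\<And>q. q \<in> S \<Longrightarrow> p q \<noteq> q \<Longrightarrow>
        a (p q) = - a q \<and> s (p q) = s q \<and> (a q)\<^sup>2 + (s q)\<^sup>2 = 1"
  shows "unitary_on S (reflection p a s)"
proof -
  let ?B = "reflection p a s"
  have sym: "?B c e = ?B e c" if "c \<in> S" "e \<in> S" for c e
  proof (cases "e = p c \<and> e \<noteq> c")
    case True
    then show ?thesis using p[OF that(1)] moved[OF that(1)] by (simp add: reflection_def)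
  next
    case False
    then show ?thesis using p[OF that(2)] by (auto simp: reflection_def)
  qed
  have real: "cnj (?B c e) = ?B c e" for c e by (simp add: reflection_def)
  have *: "(\<Sum>e\<in>S. ?B e c * ?B e c') = (if c = c' then 1 else 0)" if c: "c \<in> S" "c' \<in> S" for c c'
  proof -
    have "(\<Sum>e\<in>S. ?B e c * ?B e c') = (\<Sum>e\<in>{c, p c}. ?B e c * ?B e c')"
      using c p fin by (intro sum.mono_neutral_right) (auto simp: reflection_def)
    also have "\<dots> = (if c = c' then 1 else 0)"
    proof (cases "p c = c")
      case True
      then show ?thesis using fixed[OF c(1)] p[OF c(2)] by (auto simp: reflection_def)
    next
      case False
      have "complex_of_real (a c) * complex_of_real (a c) + complex_of_real (s c) * complex_of_real (s c)
          = complex_of_real ((a c)\<^sup>2 + (s c)\<^sup>2)"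
        by (simp add: power2_eq_square)
      then have "complex_of_real (a c) * complex_of_real (a c) + complex_of_real (s c) * complex_of_real (s c) = 1"
        using moved[OF c(1) False] by simp
      then show ?thesis
        using False moved[OF c(1) False] p[OF c(1)] p[OF c(2)] by (auto simp: reflection_def)
    qed
    finally show ?thesis .
  qed
  show ?thesis
    unfolding unitary_on_def real using * by (simp add: sym)
qed

subsection \<open>The machine\<close>

text \<open>
  The states are: 0, 1, 2 check the form \<open>a\<^sup>*b\<^sup>*\<close> on the way to the right; 3, 4
  and 5, 6 are the two paths going left, where 4 and 6 wait one step on each \<open>a\<close> resp.
  each \<open>b\<close>; 7 has survived the interference at the left end; 8, 9, 10 accept, reject, restart.
\<close>

definition head_move :: "nat \<Rightarrow> int" where
  "head_move q = (if q \<in> {0, 2} then 1 else if q \<in> {1, 3, 5} then -1 else 0)"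

definition state_kind :: "nat \<Rightarrow> outcome" where
  "state_kind q = (if q = 8 then Accept else if q = 9 then Reject else if q = 10 then Restart else Nonhalt)"

text \<open>Entries off the intended runs complete each list to a permutation. On
  \<open>LetB\<close> state 2 is already entered from 2, so 0 cannot go there directly: it turns to
  1, steps back onto an \<open>a\<close> or the left end, and enters 2 there.\<close>

fun perm :: "tape_symbol \<Rightarrow> nat list" where
  "perm LeftEnd = [0, 2, 1, 7, 4, 9, 6, 8, 3, 5, 10]"
| "perm RightEnd = [1, 0, 3, 2, 4, 5, 6, 7, 8, 9, 10]"
| "perm (Letter LetA) = [0, 2, 9, 4, 3, 5, 6, 7, 8, 1, 10]"
| "perm (Letter LetB) = [1, 0, 2, 3, 4, 6, 5, 7, 8, 9, 10]"

text \<open>3 and 5 fork at the right end; at the left end 7 and 9 interfere, while 8 and 10 divide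
  the surviving amplitude. Partners have equal head moves and so share a cell.\<close>

fun partner :: "tape_symbol \<Rightarrow> nat \<Rightarrow> nat" where
  "partner LeftEnd q = (if q = 7 then 9 else if q = 9 then 7 else if q = 8 then 10 else if q = 10 then 8 else q)"
| "partner RightEnd q = (if q = 3 then 5 else if q = 5 then 3 else q)"
| "partner (Letter l) q = q"

text \<open>Hadamard blocks have their minus sign at the larger state, so at the left end the two
  paths agree in sign on 7 and differ on 9. The block of 8 and 10 makes state 7 accept with
  probability \<open>\<epsilon>\<close>.\<close>

definition diagonal :: "real \<Rightarrow> tape_symbol \<Rightarrow> nat \<Rightarrow> real" where
  "diagonal \<epsilon> \<sigma> q =
     (if partner \<sigma> q = q then 1 else if q = 8 then sqrt \<epsilon> else if q = 10 then - sqrt \<epsilon>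
      else if q < partner \<sigma> q then 1 / sqrt 2 else - 1 / sqrt 2)"

definition off_diagonal :: "real \<Rightarrow> nat \<Rightarrow> real" where
  "off_diagonal \<epsilon> q = (if q \<in> {8, 10} then sqrt (1 - \<epsilon>) else 1 / sqrt 2)"

definition local_op :: "real \<Rightarrow> tape_symbol \<Rightarrow> nat \<Rightarrow> nat \<Rightarrow> complex" where
  "local_op \<epsilon> \<sigma> q' q = reflection (partner \<sigma>) (diagonal \<epsilon> \<sigma>) (off_diagonal \<epsilon>) q' (perm \<sigma> ! q)"

definition eq_machine :: "real \<Rightarrow> nat tqfa" where
  "eq_machine \<epsilon> = \<lparr>states = {..<11}, kind = state_kind, start = 0,
     trans = (\<lambda>q \<sigma> q' d. if d = head_move q' then local_op \<epsilon> \<sigma> q' q else 0)\<rparr>"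

lemma eq_machine_simps [simp]:
  "states (eq_machine \<epsilon>) = {..<11}" "kind (eq_machine \<epsilon>) = state_kind" "start (eq_machine \<epsilon>) = 0"
  "trans (eq_machine \<epsilon>) q \<sigma> q' d = (if d = head_move q' then local_op \<epsilon> \<sigma> q' q else 0)"
  by (simp_all add: eq_machine_def)

lemma bij_betw_perm: "bij_betw ((!) (perm \<sigma>)) {..<11} {..<11}"
proof -
  have *: "distinct (perm \<sigma>) \<and> length (perm \<sigma>) = 11 \<and> set (perm \<sigma>) = {..<11}"
    by (cases \<sigma> rule: perm.cases) (auto simp: lessThan_nat_numeral)
  then show ?thesis by (intro bij_betw_nth) simp_all
qed

lemma unitary_on_local_op:
  assumes "0 \<le> \<epsilon>" "\<epsilon> \<le> 1"
  shows "unitary_on {..<11} (local_op \<epsilon> \<sigma>)"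
proof -
  have "unitary_on {..<11} (reflection (partner \<sigma>) (diagonal \<epsilon> \<sigma>) (off_diagonal \<epsilon>))"
    by (rule unitary_on_reflection; cases \<sigma>)
       (use assms in \<open>auto simp: diagonal_def off_diagonal_def power_divide split: if_splits\<close>)
  then show ?thesis
    unfolding local_op_def by (rule unitary_on_permute[OF _ bij_betw_perm])
qed

lemma qfa_eq_machine:
  assumes "0 \<le> \<epsilon>" "\<epsilon> \<le> 1"
  shows "two_way_qfa_restart (eq_machine \<epsilon>)"
proof -
  have "unitary_on (configs (eq_machine \<epsilon>) w) (amplitude (eq_machine \<epsilon>) w)" for w
    by (rule unitary_on_unidirectional[of _ head_move "local_op \<epsilon>"])
       (simp_all add: unitary_on_local_op[OF assms] head_move_def)
  then show ?thesis by (simp add: two_way_qfa_restart_def state_kind_def)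
qed

subsection \<open>Trajectories\<close>

definition measured :: "'q tqfa \<Rightarrow> letter list \<Rightarrow> outcome \<Rightarrow> 'q qstate \<Rightarrow> 'q qstate" where
  "measured M w k \<psi> = project M w k (evolve M w \<psi>)"

lemma step_eq_measured: "step M w = measured M w Nonhalt"
  by (simp add: fun_eq_iff step_def measured_def)

lemma outcome_prob_eq_measured: "outcome_prob M w \<psi> k = (vnorm M w (measured M w k \<psi>))\<^sup>2"
  by (simp add: outcome_prob_def measured_def)

text \<open>This allows the two paths to be followed separately, their amplitudes being added just
  before squaring.\<close>

lemma measured_linear:
  "measured M w k (\<lambda>c. \<alpha> * \<psi> c + \<beta> * \<theta> c) = (\<lambda>c. \<alpha> * measured M w k \<psi> c + \<beta> * measured M w k \<theta> c)"
  by (auto simp: measured_def project_def evolve_def sum.distrib sum_distrib_left algebra_simps)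

lemma measured_scale: "measured M w k (\<lambda>c. \<alpha> * \<psi> c) = (\<lambda>c. \<alpha> * measured M w k \<psi> c)"
  using measured_linear[of M w k \<alpha> \<psi> 0 \<psi>] by simp

lemma measured_zero [simp]: "measured M w k (\<lambda>_. 0) = (\<lambda>_. 0)"
  using measured_scale[of M w k 0 "\<lambda>_. 0"] by simp

lemma steps_linear:
  "(step M w ^^ t) (\<lambda>c. \<alpha> * \<psi> c + \<beta> * \<theta> c) =
     (\<lambda>c. \<alpha> * (step M w ^^ t) \<psi> c + \<beta> * (step M w ^^ t) \<theta> c)"
  by (induction t) (simp_all add: step_eq_measured measured_linear)

lemma steps_zero [simp]: "(step M w ^^ t) (\<lambda>_. 0) = (\<lambda>_. 0)"
  by (induction t) (simp_all add: step_eq_measured)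

text \<open>A stretch in which only \<open>Nonhalt\<close> can be observed; such stretches compose,
  and for the outcomes of a round they merely shift time.\<close>

definition quiet :: "'q tqfa \<Rightarrow> letter list \<Rightarrow> nat \<Rightarrow> 'q qstate \<Rightarrow> 'q qstate \<Rightarrow> bool" where
  "quiet M w n \<phi> \<psi> \<longleftrightarrow> (step M w ^^ n) \<phi> = \<psi> \<and>
     (\<forall>t<n. \<forall>k. k \<noteq> Nonhalt \<longrightarrow> measured M w k ((step M w ^^ t) \<phi>) = (\<lambda>_. 0))"

lemma quiet_0 [simp]: "quiet M w 0 \<phi> \<phi>"
  by (simp add: quiet_def)

lemma quiet_steps:
  assumes "quiet M w n \<phi> \<psi>"
  shows "(step M w ^^ (n + t)) \<phi> = (step M w ^^ t) \<psi>"
  using assms by (simp add: quiet_def add.commute[of n] funpow_add)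

lemma quiet_measured:
  assumes "quiet M w n \<phi> \<psi>" "k \<noteq> Nonhalt"
  shows "measured M w k ((step M w ^^ t) \<phi>) =
    (if t < n then (\<lambda>_. 0) else measured M w k ((step M w ^^ (t - n)) \<psi>))"
  using assms quiet_steps[OF assms(1), of "t - n"] by (cases "t < n") (simp_all add: quiet_def)

lemma quiet_trans:
  assumes "quiet M w m \<phi> \<psi>" "quiet M w n \<psi> \<theta>"
  shows "quiet M w (m + n) \<phi> \<theta>"
  using quiet_steps[OF assms(1), of n] quiet_measured[OF assms(1)] assms(2)
  by (auto simp: quiet_def)

lemma quiet_1I:
  assumes "measured M w Nonhalt \<phi> = \<psi>" "\<And>k. k \<noteq> Nonhalt \<Longrightarrow> measured M w k \<phi> = (\<lambda>_. 0)"
  shows "quiet M w 1 \<phi> \<psi>"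
  using assms by (simp add: quiet_def step_eq_measured)

lemma sum_quiet:
  assumes "quiet M w n \<phi> \<psi>" "k \<noteq> Nonhalt"
  shows "(\<Sum>t<n + l. outcome_prob M w ((step M w ^^ t) \<phi>) k) =
    (\<Sum>t<l. outcome_prob M w ((step M w ^^ t) \<psi>) k)"
proof (induction l)
  case 0
  then show ?case using quiet_measured[OF assms] by (simp add: outcome_prob_eq_measured vnorm_sq)
next
  case (Suc l)
  then show ?case using quiet_steps[OF assms(1), of l] by simp
qed

definition ket :: "'q \<Rightarrow> nat \<Rightarrow> 'q qstate" where
  "ket q i = (\<lambda>c. if c = (q, int i) then 1 else 0)"

lemma init_eq_ket: "init M = ket (start M) 0"
  by (simp add: init_def ket_def)

lemma length_tape: "length (tape w) = length w + 2"
  by (simp add: tape_def)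

lemma tape_nth [simp]:
  "tape w ! 0 = LeftEnd" "tape w ! Suc (length w) = RightEnd"
  "i < length w \<Longrightarrow> tape w ! Suc i = Letter (w ! i)"
  by (simp_all add: tape_def nth_append)

text \<open>\<open>\<alpha>\<close> and \<open>\<beta>\<close> stand for amplitudes of the two
  paths, arriving at times \<open>i\<close> and \<open>j\<close>: simultaneous arrivals interfere,
  others contribute separate probabilities.\<close>

lemma sum_two_spikes:
  fixes \<alpha> \<beta> :: real and i j l :: nat
  assumes "i < l" "j < l"
  shows "(\<Sum>t<l. ((if t = i then \<alpha> else 0) + (if t = j then \<beta> else 0))\<^sup>2) =
    (if i = j then (\<alpha> + \<beta>)\<^sup>2 else \<alpha>\<^sup>2 + \<beta>\<^sup>2)"
proof (cases "i = j")
  case True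
  then have "(\<Sum>t<l. ((if t = i then \<alpha> else 0) + (if t = j then \<beta> else 0))\<^sup>2) =
      (\<Sum>t<l. if t = i then (\<alpha> + \<beta>)\<^sup>2 else 0)"
    by (intro sum.cong) auto
  also have "\<dots> = (\<alpha> + \<beta>)\<^sup>2" using assms(1) by simp
  finally show ?thesis using True by simp
next
  case False
  then have "(\<Sum>t<l. ((if t = i then \<alpha> else 0) + (if t = j then \<beta> else 0))\<^sup>2) =
      (\<Sum>t<l. (if t = i then \<alpha>\<^sup>2 else 0) + (if t = j then \<beta>\<^sup>2 else 0))"
    by (intro sum.cong) auto
  then show ?thesis using assms False by (simp add: sum.distrib)
qed

section \<open>Single steps of the machine on basis states\<close>

locale eq_run =
  fixes \<epsilon> :: real and w :: "letter list"
  assumes eps: "0 < \<epsilon>" "\<epsilon> \<le> 1"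
begin

abbreviation "M \<equiv> eq_machine \<epsilon>"

sublocale machine M w
  using eps by unfold_locales (simp add: qfa_eq_machine)

lemma measured_ket:
  assumes "q < 11" "i < length (tape w)"
  shows "measured M w k (ket q i) = (\<lambda>(q', j).
    if q' < 11 \<and> state_kind q' = k \<and> j = (int i + head_move q') mod int (length (tape w))
    then local_op \<epsilon> (tape w ! i) q' q else 0)"
proof -
  have mem: "(q, int i) \<in> configs M w" using assms by (simp add: configs_def)
  have "evolve M w (ket q i) c = amplitude M w c (q, int i)" for c
  proof -
    have "evolve M w (ket q i) c = (\<Sum>e\<in>configs M w. if e = (q, int i) then amplitude M w c e else 0)"
      unfolding evolve_def ket_def by (intro sum.cong) auto
    then show ?thesis using finite_configs mem by simp
  qed
  moreover have "amplitude M w (q', j) (q, int i) =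
      (if (int i + head_move q') mod int (length (tape w)) = j then local_op \<epsilon> (tape w ! i) q' q else 0)"
    for q' j
    using amplitude_unidirectional[of M head_move "local_op \<epsilon>"] by (simp add: head_move_def)
  moreover have "length (tape w) > 0" by (simp add: length_tape)
  ultimately show ?thesis
    by (auto simp: fun_eq_iff measured_def project_def configs_def)
qed

text \<open>\<open>r\<close> is its own partner, so the reflection fixes it and the step is
  classical; \<open>int i + head_move r = int i'\<close> rules out wrapping around the tape.\<close>

lemma measured_det:
  assumes "q < 11" "i < length (tape w)" "perm (tape w ! i) ! q = r" "r < 11"
    "partner (tape w ! i) r = r" "int i + head_move r = int i'" "i' < length (tape w)"
  shows "measured M w k (ket q i) = (if state_kind r = k then ket r i' else (\<lambda>_. 0))"
  unfolding measured_ket[OF assms(1,2)] using assms by (auto simp: fun_eq_iff ket_def local_op_def reflection_def diagonal_def)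

lemma measured_split:
  assumes "q < 11" "i < length (tape w)" "perm (tape w ! i) ! q = r" "r < 11" "r' < 11"
    "partner (tape w ! i) r = r'" "r \<noteq> r'" "head_move r' = head_move r"
    "int i + head_move r = int i'" "i' < length (tape w)"
  shows "measured M w k (ket q i) =
    (\<lambda>c. complex_of_real (if state_kind r = k then diagonal \<epsilon> (tape w ! i) r else 0) * ket r i' c +
         complex_of_real (if state_kind r' = k then off_diagonal \<epsilon> r else 0) * ket r' i' c)"
  unfolding measured_ket[OF assms(1,2)] using assms by (auto simp: fun_eq_iff ket_def local_op_def reflection_def)

lemma quiet_det:
  assumes "q < 11" "i < length (tape w)" "perm (tape w ! i) ! q = r" "r < 11"
    "partner (tape w ! i) r = r" "int i + head_move r = int i'" "i' < length (tape w)"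
    "state_kind r = Nonhalt"
  shows "quiet M w 1 (ket q i) (ket r i')"
  using measured_det[OF assms(1-7)] assms(8) by (intro quiet_1I) simp_all

section \<open>Deterministic sweeps: form check and way back\<close>

lemma quiet_right_a:
  assumes "i \<le> length w" "\<And>j. j < i \<Longrightarrow> w ! j = LetA"
  shows "quiet M w (Suc i) (ket 0 0) (ket 0 (Suc i))"
  using assms
proof (induction i)
  case 0
  have "quiet M w 1 (ket 0 0) (ket 0 (Suc 0))"
    by (rule quiet_det) (simp_all add: length_tape head_move_def state_kind_def)
  then show ?case by simp
next
  case (Suc i)
  have "quiet M w 1 (ket 0 (Suc i)) (ket 0 (Suc (Suc i)))"
    using Suc.prems by (intro quiet_det) (simp_all add: length_tape head_move_def state_kind_def)
  moreover have "quiet M w (Suc i) (ket 0 0) (ket 0 (Suc i))" using Suc by simp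
  ultimately show ?case using quiet_trans by fastforce
qed

lemma quiet_turn:
  assumes "n \<le> length w" "\<And>j. j < n \<Longrightarrow> w ! j = LetA" "n < length w \<Longrightarrow> w ! n = LetB"
  shows "quiet M w 2 (ket 0 (Suc n)) (ket 2 (Suc n))"
proof -
  have "tape w ! Suc n = RightEnd \<or> tape w ! Suc n = Letter LetB"
    using assms by (cases "n = length w") auto
  then have 1: "quiet M w 1 (ket 0 (Suc n)) (ket 1 n)"
    using assms(1) by (intro quiet_det) (auto simp: length_tape head_move_def state_kind_def)
  \<comment> \<open>For \<open>n = 0\<close> the step back reaches the left end, otherwise the last
    \<open>a\<close> of the block.\<close>
  have "tape w ! n = LeftEnd \<or> tape w ! n = Letter LetA"
    using assms by (cases n) auto
  then have 2: "quiet M w 1 (ket 1 n) (ket 2 (Suc n))"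
    using assms(1) by (intro quiet_det) (auto simp: length_tape head_move_def state_kind_def)
  show ?thesis using quiet_trans[OF 1 2] by (simp add: numeral_2_eq_2)
qed

lemma quiet_right_b:
  assumes "n + m \<le> length w" "\<And>j. n \<le> j \<Longrightarrow> j < n + m \<Longrightarrow> w ! j = LetB"
  shows "quiet M w m (ket 2 (Suc n)) (ket 2 (Suc (n + m)))"
  using assms
proof (induction m)
  case (Suc m)
  have "quiet M w 1 (ket 2 (Suc (n + m))) (ket 2 (Suc (n + Suc m)))"
    using Suc.prems by (intro quiet_det) (simp_all add: length_tape head_move_def state_kind_def)
  moreover have "quiet M w m (ket 2 (Suc n)) (ket 2 (Suc (n + m)))" using Suc by simp
  ultimately show ?case using quiet_trans by fastforce
qed simp

text \<open>The time is \<open>n + 1\<close> over the left end and the \<open>a\<close>s, 2 for the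
  turn and \<open>m\<close> over the \<open>b\<close>s. The tail \<open>u\<close> covers ill-formed
  words; the premise on it ensures that the \<open>a\<close>s are followed by a \<open>b\<close> or
  the right end.\<close>

lemma quiet_form_check:
  assumes w: "w = replicate n LetA @ replicate m LetB @ u" and u: "m = 0 \<Longrightarrow> u = []"
  shows "quiet M w (n + m + 3) (init M) (ket 2 (Suc (n + m)))"
proof -
  have "quiet M w (Suc n) (ket 0 0) (ket 0 (Suc n))"
    by (rule quiet_right_a) (auto simp: w nth_append)
  also have "quiet M w 2 (ket 0 (Suc n)) (ket 2 (Suc n))"
    using u by (intro quiet_turn) (auto simp: w nth_append)
  finally (quiet_trans) have "quiet M w (Suc n + 2) (ket 0 0) (ket 2 (Suc n))" .
  also have "quiet M w m (ket 2 (Suc n)) (ket 2 (Suc (n + m)))"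
    by (rule quiet_right_b) (auto simp: w nth_append)
  finally (quiet_trans) show ?thesis by (simp add: init_eq_ket add_ac numeral_3_eq_3)
qed

text \<open>Leaving a cell takes one step, or two via the waiting state \<open>q'\<close> if it
  holds \<open>l\<close>; the arrival time thus counts the letters \<open>l\<close>.\<close>

lemma quiet_left:
  fixes q q' :: nat
  assumes q: "(q, q', l) \<in> {(3, 4, LetA), (5, 6, LetB)}" and "i \<le> length w"
  shows "quiet M w (i + count_list (take i w) l) (ket q i) (ket q 0)"
  using assms(2)
proof (induction i)
  case (Suc i)
  have "quiet M w (if w ! i = l then 2 else 1) (ket q (Suc i)) (ket q i)"
  proof (cases "w ! i = l")
    case True
    have 1: "quiet M w 1 (ket q (Suc i)) (ket q' (Suc i))"
      using Suc.prems q True by (intro quiet_det) (auto simp: length_tape head_move_def state_kind_def)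
    have 2: "quiet M w 1 (ket q' (Suc i)) (ket q i)"
      using Suc.prems q True by (intro quiet_det) (auto simp: length_tape head_move_def state_kind_def)
    show ?thesis using quiet_trans[OF 1 2] True by (simp add: numeral_2_eq_2)
  next
    case False
    then have "w ! i = (if l = LetA then LetB else LetA)" by (cases l; cases "w ! i") auto
    then have "quiet M w 1 (ket q (Suc i)) (ket q i)"
      using Suc.prems q by (intro quiet_det) (auto simp: length_tape head_move_def state_kind_def)
    with False show ?thesis by simp
  qed
  from quiet_trans[OF this Suc.IH] Suc.prems show ?case
    by (simp add: take_Suc_conv_app_nth split: if_splits)
qed simp

section \<open>Interference at the left end and outcome of a round\<close>

lemma vnorm_scaled_ket:
  assumes "q < 11" "i < length (tape w)"
  shows "(vnorm M w (\<lambda>c. complex_of_real r * ket q i c))\<^sup>2 = r\<^sup>2"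
proof -
  have "(q, int i) \<in> configs M w" using assms by (simp add: configs_def)
  moreover have "(vnorm M w (\<lambda>c. complex_of_real r * ket q i c))\<^sup>2 =
      (\<Sum>c\<in>configs M w. if c = (q, int i) then r\<^sup>2 else 0)"
    unfolding vnorm_sq ket_def by (intro sum.cong) auto
  ultimately show ?thesis using finite_configs by simp
qed

text \<open>Both paths enter 7 with amplitude \<open>1 / sqrt 2\<close>, and 9 with opposite signs
  \<open>s\<close>. One step later 7 turns into 8 and 10, so nothing nonhalting is left after two
  steps.\<close>

lemma left_end_paths:
  assumes "(q, s) \<in> {(3, 1), (5, - 1)}"
  shows "measured M w Reject ((step M w ^^ t) (ket q 0)) =
      (\<lambda>c. complex_of_real (if t = 0 then s / sqrt 2 else 0) * ket 9 0 c)" (is ?rej)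
    and "measured M w Accept ((step M w ^^ t) (ket q 0)) =
      (\<lambda>c. complex_of_real (if t = 1 then sqrt \<epsilon> / sqrt 2 else 0) * ket 8 0 c)" (is ?acc)
    and "(step M w ^^ (t + 2)) (ket q 0) = (\<lambda>_. 0)" (is ?vanish)
proof -
  let ?h = "complex_of_real (1 / sqrt 2)"
  have q: "measured M w k (ket q 0) =
      (\<lambda>c. complex_of_real (if k = Nonhalt then 1 / sqrt 2 else 0) * ket 7 0 c +
           complex_of_real (if k = Reject then s / sqrt 2 else 0) * ket 9 0 c)" for k
  proof -
    consider "q = 3" "s = 1" | "q = 5" "s = -1" using assms by auto
    then show ?thesis
    proof cases
      case 1
      show ?thesis using 1
        by (subst measured_split[where r = 7 and r' = 9 and i' = 0])
           (auto simp: length_tape head_move_def state_kind_def diagonal_def off_diagonal_def fun_eq_iff)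
    next
      case 2
      show ?thesis using 2
        by (subst measured_split[where r = 9 and r' = 7 and i' = 0])
           (auto simp: length_tape head_move_def state_kind_def diagonal_def off_diagonal_def fun_eq_iff)
    qed
  qed
  have 7: "measured M w k (ket 7 0) =
      (\<lambda>c. complex_of_real (if k = Accept then sqrt \<epsilon> else 0) * ket 8 0 c +
           complex_of_real (if k = Restart then sqrt (1 - \<epsilon>) else 0) * ket 10 0 c)" for k
    by (subst measured_split[where r = 8 and r' = 10 and i' = 0])
       (auto simp: length_tape head_move_def state_kind_def diagonal_def off_diagonal_def fun_eq_iff)
  have step1: "step M w (ket q 0) = (\<lambda>c. ?h * ket 7 0 c)"
    unfolding step_eq_measured by (subst q) simp
  have step2: "step M w (step M w (ket q 0)) = (\<lambda>_. 0)"
    unfolding step1 unfolding step_eq_measured measured_scale 7 by simp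
  show vanish: "(step M w ^^ (t + 2)) (ket q 0) = (\<lambda>_. 0)" for t
    unfolding funpow_add o_apply by (simp add: numeral_2_eq_2 step2)
  have "t = 0 \<or> t = 1 \<or> t = (t - 2) + 2" by arith
  then consider "t = 0" | "t = 1" | "t = (t - 2) + 2" by blast
  then have "?rej \<and> ?acc"
  proof cases
    case 1
    then show ?thesis by (simp add: q)
  next
    case 2
    have "measured M w k (step M w (ket q 0)) = (\<lambda>c. ?h * measured M w k (ket 7 0) c)" for k
      unfolding step1 by (rule measured_scale)
    with 2 show ?thesis by (simp add: 7)
  next
    case 3
    have "(step M w ^^ t) (ket q 0) = (\<lambda>_. 0)" by (subst 3) (rule vanish)
    moreover have "t \<noteq> 0" "t \<noteq> 1" using 3 by arith+
    ultimately show ?thesis by simp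
  qed
  then show ?rej ?acc by blast+
qed

text \<open>The events at the left end, delayed by the travel time \<open>T\<close>: one step per
  cell and one pause per letter \<open>l\<close>.\<close>

lemma paths:
  assumes "(q, s, l) \<in> {(3, 1, LetA), (5, - 1, LetB)}"
  defines "T \<equiv> length w + count_list w l"
  shows "measured M w Reject ((step M w ^^ t) (ket q (length w))) =
      (\<lambda>c. complex_of_real (if t = T then s / sqrt 2 else 0) * ket 9 0 c)"
    and "measured M w Accept ((step M w ^^ t) (ket q (length w))) =
      (\<lambda>c. complex_of_real (if t = T + 1 then sqrt \<epsilon> / sqrt 2 else 0) * ket 8 0 c)"
    and "T + 2 \<le> t \<Longrightarrow> (step M w ^^ t) (ket q (length w)) = (\<lambda>_. 0)"
proof -
  have qs: "(q, s) \<in> {(3, 1), (5, - 1)}" using assms(1) by auto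
  have Q: "quiet M w T (ket q (length w)) (ket q 0)"
    using quiet_left[of q "q + 1" l "length w"] assms by auto
  show "measured M w Reject ((step M w ^^ t) (ket q (length w))) =
      (\<lambda>c. complex_of_real (if t = T then s / sqrt 2 else 0) * ket 9 0 c)"
    by (subst quiet_measured[OF Q]) (auto simp: left_end_paths(1)[OF qs])
  show "measured M w Accept ((step M w ^^ t) (ket q (length w))) =
      (\<lambda>c. complex_of_real (if t = T + 1 then sqrt \<epsilon> / sqrt 2 else 0) * ket 8 0 c)"
    by (subst quiet_measured[OF Q]) (auto simp: left_end_paths(2)[OF qs])
  show "(step M w ^^ t) (ket q (length w)) = (\<lambda>_. 0)" if "T + 2 \<le> t"
  proof -
    have "t = T + ((t - T - 2) + 2)" using that by simp
    then show ?thesis using quiet_steps[OF Q] left_end_paths(3)[OF qs] by metis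
  qed
qed

lemma quiet_fork:
  "quiet M w 1 (ket 2 (Suc (length w)))
     (\<lambda>c. complex_of_real (1 / sqrt 2) * ket 3 (length w) c + complex_of_real (1 / sqrt 2) * ket 5 (length w) c)"
proof -
  have "measured M w k (ket 2 (Suc (length w))) =
      (\<lambda>c. complex_of_real (if k = Nonhalt then 1 / sqrt 2 else 0) * ket 3 (length w) c +
           complex_of_real (if k = Nonhalt then 1 / sqrt 2 else 0) * ket 5 (length w) c)" for k
    by (subst measured_split[where r = 3 and r' = 5 and i' = "length w"])
       (auto simp: length_tape head_move_def state_kind_def diagonal_def off_diagonal_def fun_eq_iff)
  then show ?thesis by (intro quiet_1I) auto
qed

text \<open>With the factor \<open>1 / sqrt 2\<close> of the fork, the paths carry
  \<open>1 / 2\<close> and \<open>- 1 / 2\<close> into rejection and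
  \<open>sqrt \<epsilon> / 2\<close> each into acceptance. For \<open>n = m\<close> they arrive
  together, giving 0 and \<open>\<epsilon>\<close>; otherwise the squares add up to
  \<open>1 / 2\<close> and \<open>\<epsilon> / 2\<close>.\<close>

lemma round_well_formed:
  assumes w: "w = replicate n LetA @ replicate m LetB"
  obtains T where "real T \<le> 9 * max 1 (real (length w))"
    "vnorm M w ((step M w ^^ T) (init M)) = 0"
    "round_prob T Accept = (if n = m then \<epsilon> else \<epsilon> / 2)"
    "round_prob T Reject = (if n = m then 0 else 1 / 2)"
proof -
  let ?h = "complex_of_real (1 / sqrt 2)"
  let ?\<phi> = "\<lambda>c. ?h * ket 3 (length w) c + ?h * ket 5 (length w) c"
  define a where "a = length w + count_list w LetA"
  define b where "b = length w + count_list w LetB"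
  \<comment> \<open>Each path is extinct two steps after its arrival.\<close>
  define l where "l = max a b + 2"
  have cnt: "count_list (replicate k x) y = (if x = y then k else 0)" for k and x y :: letter
    by (induction k) auto
  have ab: "a = b \<longleftrightarrow> n = m" by (simp add: a_def b_def w cnt)
  have l: "a < l" "b < l" "a + 1 < l" "b + 1 < l" by (simp_all add: l_def)
  have len: "length w = n + m" by (simp add: w)
  have path3: "(3, 1, LetA) \<in> {(3, 1, LetA), (5, - 1 :: real, LetB)}" by simp
  have path5: "(5, - 1, LetB) \<in> {(3, 1, LetA), (5, - 1 :: real, LetB)}" by simp
  note p3 = paths[OF path3, folded a_def] and p5 = paths[OF path5, folded b_def]
  have Q: "quiet M w (n + m + 3 + 1) (init M) ?\<phi>"
    using quiet_trans[OF quiet_form_check[of n m "[]"] quiet_fork[unfolded len]] by (simp add: w len)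
  have pos: "0 < length (tape w)" by (simp add: length_tape)
  have rej: "outcome_prob M w ((step M w ^^ t) ?\<phi>) Reject =
      ((if t = a then 1 / 2 else 0) + (if t = b then - 1 / 2 else 0))\<^sup>2" for t
  proof -
    have "measured M w Reject ((step M w ^^ t) ?\<phi>) = (\<lambda>c. complex_of_real
        ((if t = a then 1 / 2 else 0) + (if t = b then - 1 / 2 else 0)) * ket 9 0 c)"
      unfolding steps_linear measured_linear p3 p5
      by (auto simp: fun_eq_iff field_simps simp flip: of_real_mult)
    then show ?thesis by (simp only: outcome_prob_eq_measured vnorm_scaled_ket pos)
  qed
  have acc: "outcome_prob M w ((step M w ^^ t) ?\<phi>) Accept =
      ((if t = a + 1 then sqrt \<epsilon> / 2 else 0) + (if t = b + 1 then sqrt \<epsilon> / 2 else 0))\<^sup>2" for t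
  proof -
    have "measured M w Accept ((step M w ^^ t) ?\<phi>) = (\<lambda>c. complex_of_real
        ((if t = a + 1 then sqrt \<epsilon> / 2 else 0) + (if t = b + 1 then sqrt \<epsilon> / 2 else 0)) * ket 8 0 c)"
      unfolding steps_linear measured_linear p3 p5
      by (auto simp: fun_eq_iff field_simps simp flip: of_real_mult)
    then show ?thesis by (simp only: outcome_prob_eq_measured vnorm_scaled_ket pos)
  qed
  show thesis
  proof (rule that[of "n + m + 3 + 1 + l"])
    have "count_list w LetA \<le> length w" "count_list w LetB \<le> length w"
      by (simp_all add: count_le_length)
    \<comment> \<open>The fork is complete after \<open>n + m + 4\<close> steps, and
      \<open>l\<close> is at most twice the input length plus 2.\<close>
    then have "n + m + 3 + 1 + l \<le> 3 * length w + 6" by (simp add: l_def a_def b_def len)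
    then show "real (n + m + 3 + 1 + l) \<le> 9 * max 1 (real (length w))" by linarith
    have "(step M w ^^ l) ?\<phi> = (\<lambda>_. 0)"
      unfolding steps_linear by (subst p3(3), simp add: l_def, subst p5(3)) (simp_all add: l_def)
    then show "vnorm M w ((step M w ^^ (n + m + 3 + 1 + l)) (init M)) = 0"
      unfolding quiet_steps[OF Q] by (simp add: vnorm_def L2_set_def)
    show "round_prob (n + m + 3 + 1 + l) Accept = (if n = m then \<epsilon> else \<epsilon> / 2)"
      unfolding sum_quiet[OF Q outcome.distinct(3)] acc sum_two_spikes[OF l(3,4)]
      using eps(1) by (simp add: ab power_divide)
    show "round_prob (n + m + 3 + 1 + l) Reject = (if n = m then 0 else 1 / 2)"
      unfolding sum_quiet[OF Q outcome.distinct(7)] rej sum_two_spikes[OF l(1,2)]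
      by (simp add: ab power_divide)
  qed
qed

text \<open>State 2 reads an \<open>a\<close> behind the block of \<open>b\<close>s and goes to 9
  with certainty, so the first round already rejects.\<close>

lemma round_ill_formed:
  assumes w: "w = replicate n LetA @ replicate m LetB @ LetA # u" and "m > 0"
  obtains T where "real T \<le> 9 * max 1 (real (length w))"
    "vnorm M w ((step M w ^^ T) (init M)) = 0"
    "round_prob T Accept = 0" "round_prob T Reject = 1"
proof (rule that[of "n + m + 3 + 1"])
  let ?\<phi> = "ket 2 (Suc (n + m))"
  have Q: "quiet M w (n + m + 3) (init M) ?\<phi>"
    using quiet_form_check[of n m "LetA # u"] assms by simp
  have nth: "w ! (n + m) = LetA" and len: "n + m < length w" by (auto simp: w nth_append)
  have m: "measured M w k ?\<phi> = (if k = Reject then ket 9 (Suc (n + m)) else (\<lambda>_. 0))" for k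
    using len nth
    by (subst measured_det[where r = 9 and i' = "Suc (n + m)"])
       (auto simp: length_tape head_move_def state_kind_def)
  have one: "(vnorm M w (ket 9 (Suc (n + m))))\<^sup>2 = 1"
    using vnorm_scaled_ket[of 9 "Suc (n + m)" 1] len by (simp add: length_tape)
  have zero: "vnorm M w (\<lambda>_. 0) = 0" by (simp add: vnorm_def L2_set_def)
  show "real (n + m + 3 + 1) \<le> 9 * max 1 (real (length w))" using len by linarith
  show "vnorm M w ((step M w ^^ (n + m + 3 + 1)) (init M)) = 0"
    unfolding quiet_steps[OF Q] by (simp add: step_eq_measured m zero)
  show "round_prob (n + m + 3 + 1) Accept = 0"
    by (subst sum_quiet[OF Q]) (simp_all add: outcome_prob_eq_measured m zero)
  show "round_prob (n + m + 3 + 1) Reject = 1"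
    by (subst sum_quiet[OF Q]) (simp_all add: outcome_prob_eq_measured m one)
qed

end

section \<open>Classification of words and correctness\<close>

lemma letters_cases:
  obtains n m where "w = replicate n LetA @ replicate m LetB"
  | n m u where "w = replicate n LetA @ replicate m LetB @ LetA # u" "m > 0"
proof -
  have not_a: "x \<noteq> LetA \<longleftrightarrow> x = LetB" for x by (cases x) auto
  define v where "v = dropWhile (\<lambda>x. x = LetA) w"
  define u where "u = dropWhile (\<lambda>x. x = LetB) v"
  have 1: "takeWhile (\<lambda>x. x = LetA) w = replicate (length (takeWhile (\<lambda>x. x = LetA) w)) LetA"
    by (rule replicate_eqI) (auto dest: set_takeWhileD)
  have 2: "takeWhile (\<lambda>x. x = LetB) v = replicate (length (takeWhile (\<lambda>x. x = LetB) v)) LetB"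
    by (rule replicate_eqI) (auto dest: set_takeWhileD)
  have w: "w = takeWhile (\<lambda>x. x = LetA) w @ takeWhile (\<lambda>x. x = LetB) v @ u"
    by (simp add: v_def u_def)
  show thesis
  proof (cases u)
    case Nil
    with w 1 2 show thesis by (metis append_Nil2 that(1))
  next
    case (Cons x u')
    then have "x = LetA" using hd_dropWhile[of "\<lambda>x. x = LetB" v] not_a by (auto simp: u_def)
    \<comment> \<open>What remains behind the longest prefix of \<open>a\<close>s is nonempty and
      hence starts with a \<open>b\<close>; this gives \<open>m > 0\<close>.\<close>
    moreover have "v \<noteq> []" using Cons by (auto simp: u_def)
    then have "hd v = LetB" using hd_dropWhile[of "\<lambda>x. x = LetA" w] not_a by (auto simp: v_def)
    then have "length (takeWhile (\<lambda>x. x = LetB) v) > 0" using \<open>v \<noteq> []\<close> by (cases v) auto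
    ultimately show thesis using w 1 2 Cons by (metis that(2))
  qed
qed

lemma well_formed_in_L_eq: "replicate n LetA @ replicate m LetB \<in> L_eq \<longleftrightarrow> n = m"
proof
  assume "replicate n LetA @ replicate m LetB \<in> L_eq"
  then obtain k where k: "replicate n LetA @ replicate m LetB = replicate k LetA @ replicate k LetB"
    by (auto simp: L_eq_def)
  have "length (filter ((=) x) (replicate n LetA @ replicate m LetB)) =
      length (filter ((=) x) (replicate k LetA @ replicate k LetB))" for x
    by (simp only: k)
  from this[of LetA] this[of LetB] show "n = m" by simp
qed (auto simp: L_eq_def)

lemma ill_formed_notin_L_eq:
  assumes "m > 0"
  shows "replicate n LetA @ replicate m LetB @ LetA # u \<notin> L_eq" (is "?w \<notin> _")
proof
  assume "?w \<in> L_eq"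
  then obtain k where k: "?w = replicate k LetA @ replicate k LetB" by (auto simp: L_eq_def)
  have "?w ! n = LetB" "?w ! (n + m) = LetA" using assms by (auto simp: nth_append)
  moreover have "n + m < 2 * k" using arg_cong[OF k, of length] by simp
  ultimately show False unfolding k by (auto simp: nth_append split: if_splits)
qed

text \<open>A round accepts and rejects with probabilities \<open>(\<epsilon>, 0)\<close> for
  members and \<open>(\<epsilon> / 2, 1 / 2)\<close> or \<open>(0, 1)\<close> for nonmembers.
  Conditioning on halting gives acceptance 1 and rejection \<open>1 / (1 + \<epsilon>)\<close> or
  1.\<close>

lemma eq_machine_correct:
  assumes "0 < \<epsilon>" "\<epsilon> \<le> 1"
  shows "w \<in> L_eq \<Longrightarrow> accept_prob (eq_machine \<epsilon>) w = 1"
    and "w \<notin> L_eq \<Longrightarrow> reject_prob (eq_machine \<epsilon>) w \<ge> ennreal (1 - \<epsilon>)"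
    and "expected_runtime (eq_machine \<epsilon>) w \<le> ennreal (18 * (1 / \<epsilon>) * max 1 (real (length w)))"
proof -
  interpret eq_run \<epsilon> w using assms by unfold_locales
  obtain T where T: "real T \<le> 9 * max 1 (real (length w))"
      "vnorm M w ((step M w ^^ T) (init M)) = 0"
    and acc: "round_prob T Accept = (if w \<in> L_eq then \<epsilon> else if round_prob T Reject = 1 then 0 else \<epsilon> / 2)"
    and rej: "round_prob T Reject = 0 \<and> w \<in> L_eq \<or> round_prob T Reject \<in> {1 / 2, 1} \<and> w \<notin> L_eq"
  proof (cases w rule: letters_cases)
    case (1 n m)
    show thesis by (rule round_well_formed[OF 1], rule that) (auto simp: 1 well_formed_in_L_eq split: if_splits)
  next
    case (2 n m u)
    show thesis by (rule round_ill_formed[OF 2], rule that) (use 2 in \<open>auto simp: ill_formed_notin_L_eq\<close>)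
  qed
  have low: "\<epsilon> / 2 \<le> round_prob T Accept + round_prob T Reject"
    using acc rej assms by auto
  then have halts: "0 < round_prob T Accept + round_prob T Reject" using assms by linarith
  show "accept_prob M w = 1" if "w \<in> L_eq"
    using acc rej that assms by (simp add: accept_prob_eq[OF T(2) halts])
  show "reject_prob M w \<ge> ennreal (1 - \<epsilon>)" if "w \<notin> L_eq"
  proof -
    \<comment> \<open>In the well-formed case this is
      \<open>(1 - \<epsilon>) * (1 + \<epsilon>) \<le> 1\<close>.\<close>
    have "1 - \<epsilon> \<le> round_prob T Reject / (round_prob T Accept + round_prob T Reject)"
      using acc rej that assms by (auto simp: field_simps)
    then show ?thesis unfolding reject_prob_eq[OF T(2) halts] by (rule ennreal_leI)
  qed
  \<comment> \<open>The factor 18 is the round length constant 9 divided by the \<open>1 / 2\<close>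
    in the halting probability \<open>\<epsilon> / 2\<close>.\<close>
  have "real T / (round_prob T Accept + round_prob T Reject) \<le> (9 * max 1 (real (length w))) / (\<epsilon> / 2)"
    using T(1) low assms by (intro frac_le) auto
  also have "\<dots> = 18 * (1 / \<epsilon>) * max 1 (real (length w))" by simp
  finally show "expected_runtime M w \<le> ennreal (18 * (1 / \<epsilon>) * max 1 (real (length w)))"
    using expected_runtime_le[OF T(2) halts] by (meson ennreal_leI order_trans)
qed

theorem theorem20:
  "\<exists>(n :: nat) (C :: real). \<forall>\<epsilon> :: real. \<epsilon> > 0 \<longrightarrow>
     (\<exists>M :: nat tqfa.
        two_way_qfa_restart M \<and> card (states M) = n \<and>
        recognizes_one_sided M L_eq \<epsilon> \<and>
        (\<forall>w. expected_runtime M w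
               \<le> ennreal (C * max 1 (1 / \<epsilon>) * max 1 (real (length w)))))"
proof (rule exI[of _ 11], rule exI[of _ 18], intro allI impI)
  fix \<epsilon> :: real assume "\<epsilon> > 0"
  \<comment> \<open>The amplitude \<open>sqrt \<epsilon>\<close> requires
    \<open>\<epsilon> \<le> 1\<close>, so larger bounds are replaced by 1, which only strengthens
    the demand on rejection; hence the factor \<open>max 1 (1 / \<epsilon>)\<close>.\<close>
  define \<delta> where "\<delta> = min \<epsilon> 1"
  have \<delta>: "0 < \<delta>" "\<delta> \<le> 1" "1 / \<delta> = max 1 (1 / \<epsilon>)" "ennreal (1 - \<epsilon>) \<le> ennreal (1 - \<delta>)"
    using \<open>\<epsilon> > 0\<close> by (auto simp: \<delta>_def min_def max_def field_simps intro: ennreal_leI)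
  show "\<exists>M :: nat tqfa.
        two_way_qfa_restart M \<and> card (states M) = 11 \<and>
        recognizes_one_sided M L_eq \<epsilon> \<and>
        (\<forall>w. expected_runtime M w
               \<le> ennreal (18 * max 1 (1 / \<epsilon>) * max 1 (real (length w))))"
  proof (intro exI[of _ "eq_machine \<delta>"] conjI allI)
    show "two_way_qfa_restart (eq_machine \<delta>)" using \<delta> by (simp add: qfa_eq_machine)
    show "recognizes_one_sided (eq_machine \<delta>) L_eq \<epsilon>"
      unfolding recognizes_one_sided_def
      using eq_machine_correct(1,2)[OF \<delta>(1,2)] \<delta>(4) by (blast intro: order_trans)
    show "expected_runtime (eq_machine \<delta>) w
        \<le> ennreal (18 * max 1 (1 / \<epsilon>) * max 1 (real (length w)))" for w
      using eq_machine_correct(3)[OF \<delta>(1,2), of w] unfolding \<delta>(3) .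
  qed simp
qed

end
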